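(* Consider any adaptive one-query quantile process $\mathrm{Quantile}(\delta)$, or any adaptive one-query threshold process $\mathrm{Threshold}(f)$, allocating $m = K \cdot n \sqrt{\log n}$ balls into $n$ bins, where $K = 1/10$. Then \[ \Pr\Big[\mathrm{Gap}(m) \geq \tfrac{1}{20} \sqrt{\log n}\Big] \geq 1-o(n^{-2}). \]
   Context: Balls are allocated sequentially into $n$ bins, starting from all loads $0$. Let $x_i^{(t)}$ be the load of bin $i$ after $t$ balls, and $\mathrm{Gap}(t) := \max_{i} x_i^{(t)} - t/n$. Let $y^{(t)}$ be the load vector sorted in non-increasing order, and let $\mathrm{Rank}^{(t)}$ be a permutation of $[n]$ with $y^{(t)}_{\mathrm{Rank}^{(t)}(i)} = x_i^{(t)}$ (rank $1$ = most loaded; ties broken arbitrarily). In the one-query quantile process $\mathrm{Quantile}(\delta)$, at each step $t$ a value $\delta(t) \in \{1/n, \ldots, 1\}$ is used; two bins are sampled independently and uniformly at random (with replacement), and each is asked whether its rank is at most $\delta(t) n$; if exactly one of the two bins has rank $> \delta(t) n$, the ball is placed into it, otherwise into one of the two chosen uniformly at random. In the one-query threshold process $\mathrm{Threshold}(f)$, at step $t$ a value $f(t)$ is used, each of the two sampled bins is asked whether its load is at least $f(t)$, and the ball goes to the bin with load below $f(t)$ if exactly one exists, otherwise to a uniformly random one of the two. Adaptive means $\delta(t)$ (resp. $f(t)$) may depend on the entire history (the load vector before step $t$). As throughout the paper, $n$ is assumed sufficiently large. *)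

theory Defs
  imports "HOL-Probability.Probability" "HOL-Library.Landau_Symbols"
begin

text \<open>
  The bins are \<open>{1..n}\<close>. A history is the list of bins that have received the balls so far,
  most recent ball first. Together with its suffixes it carries the same information as the
  sequence of load vectors up to the present, and its length is the number of balls.
\<close>

type_synonym history = "nat list"

definition load :: "history \<Rightarrow> nat \<Rightarrow> nat" where
  "load h i = count_list h i"

definition gap :: "nat \<Rightarrow> history \<Rightarrow> real" where
  "gap n h = real (MAX i\<in>{1..n}. load h i) - real (length h) / real n"

definition sorted_load :: "nat \<Rightarrow> history \<Rightarrow> nat \<Rightarrow> nat" where
  "sorted_load n h k = rev (sort (map (load h) [1..<Suc n])) ! (k - 1)"

definition is_rank :: "nat \<Rightarrow> history \<Rightarrow> (nat \<Rightarrow> nat) \<Rightarrow> bool" where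
  "is_rank n h r \<longleftrightarrow>
     bij_betw r {1..n} {1..n} \<and> (\<forall>i\<in>{1..n}. sorted_load n h (r i) = load h i)"

text \<open>
  In one step, \<open>Q i\<close> is the answer of bin \<open>i\<close> to the query (rank at most \<open>\<delta> n\<close>, or load at
  least \<open>f\<close>), so the ball prefers a bin that answers no. The two samples may coincide; they
  then give the same answer and \<open>pmf_of_set {i, j}\<close> is the point mass at \<open>i\<close>.
\<close>

definition one_query_step :: "nat \<Rightarrow> (nat \<Rightarrow> bool) \<Rightarrow> nat pmf" where
  "one_query_step n Q = do {
     i \<leftarrow> pmf_of_set {1..n};
     j \<leftarrow> pmf_of_set {1..n};
     if \<not> Q i \<and> Q j then return_pmf i
     else if Q i \<and> \<not> Q j then return_pmf j
     else pmf_of_set {i, j}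
   }"

primrec one_query_process :: "nat \<Rightarrow> (history \<Rightarrow> nat \<Rightarrow> bool) \<Rightarrow> nat \<Rightarrow> history pmf" where
  "one_query_process n Q 0 = return_pmf []"
| "one_query_process n Q (Suc t) = do {
     h \<leftarrow> one_query_process n Q t;
     i \<leftarrow> one_query_step n (Q h);
     return_pmf (i # h)
   }"

text \<open>
  Adaptivity: the quantile \<open>\<delta>\<close>, the threshold \<open>f\<close> and the ranking \<open>rk\<close> (that is, the way ties
  are broken) are arbitrary functions of the history before the step.
\<close>

definition adaptive_ranking :: "nat \<Rightarrow> (history \<Rightarrow> nat \<Rightarrow> nat) \<Rightarrow> bool" where
  "adaptive_ranking n rk \<longleftrightarrow> (\<forall>h\<in>lists {1..n}. is_rank n h (rk h))"

definition adaptive_quantile :: "nat \<Rightarrow> (history \<Rightarrow> real) \<Rightarrow> bool" where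
  "adaptive_quantile n \<delta> \<longleftrightarrow> (\<forall>h\<in>lists {1..n}. \<exists>k\<in>{1..n}. \<delta> h = real k / real n)"

definition quantile_process ::
    "nat \<Rightarrow> (history \<Rightarrow> nat \<Rightarrow> nat) \<Rightarrow> (history \<Rightarrow> real) \<Rightarrow> nat \<Rightarrow> history pmf" where
  "quantile_process n rk \<delta> =
     one_query_process n (\<lambda>h i. real (rk h i) \<le> \<delta> h * real n)"

definition threshold_process :: "nat \<Rightarrow> (history \<Rightarrow> real) \<Rightarrow> nat \<Rightarrow> history pmf" where
  "threshold_process n f = one_query_process n (\<lambda>h i. real (load h i) \<ge> f h)"

end

theory Submission
  imports Defs "HOL-Real_Asymp.Real_Asymp"
begin

text \<open>
  For any one-bit query, a step has the same law as: draw a uniform bin, and redraw it uniformly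
  exactly when it answers yes. So the process is driven by two independent one-choice
  sequences, the first draws and the redraws. Write \<open>L = sqrt (ln n)\<close> and \<open>l = 3/20 L\<close>, and let \<open>r\<close>
  be about \<open>l n exp (- L)\<close>. If at least \<open>r\<close> redraws occur, then these \<open>r\<close> uniform balls
  alone put \<open>l\<close> balls into some bin. If fewer occur, they spoil fewer than \<open>r\<close> bins, whereas the
  first draws put \<open>l\<close> balls into more than \<open>r\<close> bins. Both one-choice bounds come from splitting
  the balls into \<open>l\<close> phases of \<open>w\<close> balls: with \<open>\<mu> = w / n\<close>, each phase raises by one the load of
  at least a fraction \<open>\<mu>\<^sup>2 / 8\<close> of the bins raised in every earlier phase.
\<close>

section \<open>Coupling of the process with two one-choice sequences\<close>

text \<open>Swapping the two samples preserves their joint law, so it suffices that both rules agree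
  on the pairs \<open>(i, j)\<close> and \<open>(j, i)\<close> taken together. If the answers agree,
  each rule gives one unit of mass to \<open>i\<close> and one to \<open>j\<close>; if they differ,
  each gives both units to the bin that answers no.\<close>

lemma one_query_step_redraw:
  assumes "n > 0"
  shows "one_query_step n Q = do {
     u \<leftarrow> pmf_of_set {1..n};
     if Q u then pmf_of_set {1..n} else return_pmf u
   }"
proof (rule pmf_eqI)
  fix x
  let ?A = "{1..n}"
  define g where "g i j = pmf (if \<not> Q i \<and> Q j then return_pmf i
     else if Q i \<and> \<not> Q j then return_pmf j else pmf_of_set {i, j}) x" for i j
  define k where "k i j = pmf (if Q i then return_pmf j else return_pmf i) x" for i j
  have ne: "?A \<noteq> {}" "finite ?A" using assms by auto
  have sym: "g i j + g j i = k i j + k j i" for i j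
    by (cases "i = j") (auto simp: g_def k_def pmf_of_set indicator_def)
  have "2 * (\<Sum>i\<in>?A. \<Sum>j\<in>?A. g i j) = (\<Sum>i\<in>?A. \<Sum>j\<in>?A. g i j + g j i)"
    using sum.swap[of g ?A ?A] by (simp add: sum.distrib)
  also have "\<dots> = (\<Sum>i\<in>?A. \<Sum>j\<in>?A. k i j + k j i)"
    by (simp add: sym)
  also have "\<dots> = 2 * (\<Sum>i\<in>?A. \<Sum>j\<in>?A. k i j)"
    using sum.swap[of k ?A ?A] by (simp add: sum.distrib)
  finally have eq: "(\<Sum>i\<in>?A. \<Sum>j\<in>?A. g i j) = (\<Sum>i\<in>?A. \<Sum>j\<in>?A. k i j)"
    by simp
  have "pmf (one_query_step n Q) x = (\<Sum>i\<in>?A. \<Sum>j\<in>?A. g i j) / (real n * real n)"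
    unfolding one_query_step_def g_def pmf_bind_pmf_of_set[OF ne]
    by (simp add: sum_divide_distrib)
  also have "\<dots> = pmf (do {u \<leftarrow> pmf_of_set ?A; v \<leftarrow> pmf_of_set ?A;
      if Q u then return_pmf v else return_pmf u}) x"
    unfolding eq unfolding k_def pmf_bind_pmf_of_set[OF ne]
    by (simp add: sum_divide_distrib)
  \<comment> \<open>The redraw \<open>v\<close> is sampled in every case and discarded when
    \<open>Q u\<close> fails; this puts both rules on the same pairs.\<close>
  also have "(do {u \<leftarrow> pmf_of_set ?A; v \<leftarrow> pmf_of_set ?A;
      if Q u then return_pmf v else return_pmf u}) = (do {
     u \<leftarrow> pmf_of_set ?A;
     if Q u then pmf_of_set ?A else return_pmf u})"
    by (intro bind_pmf_cong refl) (simp add: bind_return_pmf')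
  finally show "pmf (one_query_step n Q) x = pmf (do {
     u \<leftarrow> pmf_of_set ?A;
     if Q u then pmf_of_set ?A else return_pmf u}) x" .
qed

text \<open>The process unrolled at its first step from an arbitrary history, which is the form that
  matches the recursion of the coupling along the first draws.\<close>

primrec one_query_from ::
    "nat \<Rightarrow> (history \<Rightarrow> nat \<Rightarrow> bool) \<Rightarrow> nat \<Rightarrow> history \<Rightarrow> history pmf" where
  "one_query_from n Q 0 h = return_pmf h"
| "one_query_from n Q (Suc t) h =
     do {i \<leftarrow> one_query_step n (Q h); one_query_from n Q t (i # h)}"

lemma one_query_from_Suc_last:
  "one_query_from n Q (Suc t) h = do {
     h' \<leftarrow> one_query_from n Q t h;
     i \<leftarrow> one_query_step n (Q h');
     return_pmf (i # h')
   }"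
proof (induction t arbitrary: h)
  case 0
  show ?case by (simp add: bind_return_pmf)
next
  case (Suc t)
  have "one_query_from n Q (Suc (Suc t)) h =
      do {i \<leftarrow> one_query_step n (Q h); one_query_from n Q (Suc t) (i # h)}"
    by simp
  also have "\<dots> = do {i \<leftarrow> one_query_step n (Q h); h' \<leftarrow> one_query_from n Q t (i # h);
     i \<leftarrow> one_query_step n (Q h'); return_pmf (i # h')}"
    by (simp only: Suc)
  finally show ?case by (simp add: bind_assoc_pmf)
qed

lemma one_query_process_conv_from: "one_query_process n Q t = one_query_from n Q t []"
  by (induction t) (simp_all only: one_query_process.simps one_query_from_Suc_last one_query_from.simps(1))

text \<open>
  The coupling: \<open>us\<close> are the first draws and \<open>vs\<close> is the queue of second draws, one of which is
  consumed whenever the first draw is answered yes.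
\<close>

primrec redirect ::
    "(history \<Rightarrow> nat \<Rightarrow> bool) \<Rightarrow> nat list \<Rightarrow> nat list \<Rightarrow> history \<Rightarrow> history" where
  "redirect Q [] vs h = h"
| "redirect Q (u # us) vs h =
     (if Q h u then redirect Q us (tl vs) (hd vs # h) else redirect Q us vs (u # h))"

text \<open>Each step consumes at most one redraw, so \<open>a \<le> b\<close> keeps the queue from
  running out and \<open>hd\<close> and \<open>tl\<close> are never applied to an empty
  list.\<close>

lemma one_query_from_conv_redirect:
  assumes "n > 0" "a \<le> b"
  shows "one_query_from n Q a h = do {
     us \<leftarrow> replicate_pmf a (pmf_of_set {1..n});
     vs \<leftarrow> replicate_pmf b (pmf_of_set {1..n});
     return_pmf (redirect Q us vs h)
   }"
  using assms(2)
proof (induction a arbitrary: b h)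
  case 0
  show ?case by (simp add: bind_return_pmf)
next
  case (Suc a)
  then obtain c where b: "b = Suc c" "a \<le> c" by (cases b) auto
  let ?U = "pmf_of_set {1..n}"
  have "one_query_from n Q (Suc a) h =
     do {u \<leftarrow> ?U; i \<leftarrow> (if Q h u then ?U else return_pmf u); one_query_from n Q a (i # h)}"
    by (simp add: one_query_step_redraw[OF assms(1)] bind_assoc_pmf)
  also have "\<dots> = do {u \<leftarrow> ?U; us \<leftarrow> replicate_pmf a ?U;
     vs \<leftarrow> replicate_pmf b ?U; return_pmf (redirect Q (u # us) vs h)}"
  proof (intro bind_pmf_cong refl)
    fix u
    show "do {i \<leftarrow> (if Q h u then ?U else return_pmf u); one_query_from n Q a (i # h)} =
      do {us \<leftarrow> replicate_pmf a ?U; vs \<leftarrow> replicate_pmf b ?U;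
          return_pmf (redirect Q (u # us) vs h)}"
    proof (cases "Q h u")
      case True
      have "do {us \<leftarrow> replicate_pmf a ?U; vs \<leftarrow> replicate_pmf b ?U;
            return_pmf (redirect Q (u # us) vs h)} =
        do {us \<leftarrow> replicate_pmf a ?U; v \<leftarrow> ?U; vs \<leftarrow> replicate_pmf c ?U;
            return_pmf (redirect Q us vs (v # h))}"
        using True by (simp add: b bind_assoc_pmf bind_return_pmf)
      also have "\<dots> = do {v \<leftarrow> ?U; us \<leftarrow> replicate_pmf a ?U; vs \<leftarrow> replicate_pmf c ?U;
            return_pmf (redirect Q us vs (v # h))}"
        \<comment> \<open>The redraw is independent of the later first draws and may be sampled
          before them.\<close>
        by (rule bind_commute_pmf)
      finally show ?thesis using True Suc.IH[OF b(2)] by simp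
    next
      case False
      then show ?thesis using Suc.IH[of b] Suc.prems by (simp add: bind_return_pmf)
    qed
  qed
  finally show ?case by (simp add: bind_assoc_pmf bind_return_pmf)
qed

text \<open>Here \<open>k\<close> is the number of redraws consumed and \<open>D\<close> the set of
  bins that lost a first draw. Each redraw spoils at most one bin, hence
  \<open>card D \<le> k\<close>.\<close>

lemma redirect_loads:
  assumes "length us \<le> length vs"
  shows "\<exists>k D. length (redirect Q us vs h) = length us + length h \<and>
     (\<forall>i. count_list (take k vs) i + count_list h i \<le> count_list (redirect Q us vs h) i) \<and>
     finite D \<and> card D \<le> k \<and>
     (\<forall>i. i \<notin> D \<longrightarrow> count_list us i + count_list h i \<le> count_list (redirect Q us vs h) i)"
  using assms
proof (induction us arbitrary: vs h)
  case Nil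
  show ?case by (intro exI[of _ 0] exI[of _ "{}"]) auto
next
  case (Cons u us)
  show ?case
  proof (cases "Q h u")
    case True
    obtain v ws where vs: "vs = v # ws" using Cons.prems by (cases vs) auto
    let ?r = "redirect Q us ws (v # h)"
    obtain k D where kD: "length ?r = length us + length (v # h)"
      "\<And>i. count_list (take k ws) i + count_list (v # h) i \<le> count_list ?r i"
      "finite D" "card D \<le> k"
      "\<And>i. i \<notin> D \<Longrightarrow> count_list us i + count_list (v # h) i \<le> count_list ?r i"
      using Cons.IH[of ws "v # h"] Cons.prems vs by (auto simp del: count_list.simps)
    have r: "redirect Q (u # us) vs h = ?r" using True vs by simp
    show ?thesis unfolding r
    proof (intro exI[of _ "Suc k"] exI[of _ "insert u D"] conjI allI impI)
      show "card (insert u D) \<le> Suc k" using kD(3,4) by (simp add: card_insert_if)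
      show "length ?r = length (u # us) + length h" using kD(1) by simp
      show "count_list (take (Suc k) vs) i + count_list h i \<le> count_list ?r i" for i
        using kD(2)[of i] vs by (auto split: if_splits)
      show "count_list (u # us) i + count_list h i \<le> count_list ?r i" if "i \<notin> insert u D" for i
        using kD(5)[of i] that by (auto split: if_splits)
    qed (use kD in auto)
  next
    case False
    let ?r = "redirect Q us vs (u # h)"
    obtain k D where kD: "length ?r = length us + length (u # h)"
      "\<And>i. count_list (take k vs) i + count_list (u # h) i \<le> count_list ?r i"
      "finite D" "card D \<le> k"
      "\<And>i. i \<notin> D \<Longrightarrow> count_list us i + count_list (u # h) i \<le> count_list ?r i"
      using Cons.IH[of vs "u # h"] Cons.prems by (auto simp del: count_list.simps)
    have r: "redirect Q (u # us) vs h = ?r" using False by simp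
    show ?thesis unfolding r
    proof (intro exI[of _ "k"] exI[of _ "D"] conjI allI impI)
      show "length ?r = length (u # us) + length h" using kD(1) by simp
      show "count_list (take k vs) i + count_list h i \<le> count_list ?r i" for i
        using kD(2)[of i] by (auto split: if_splits)
      show "count_list (u # us) i + count_list h i \<le> count_list ?r i" if "i \<notin> D" for i
        using kD(5)[of i] that by (auto split: if_splits)
    qed (use kD in auto)
  qed
qed

lemma count_list_take_le: "count_list (take k xs) i \<le> count_list xs i"
  by (metis append_take_drop_id count_list_append le_add1)

definition loaded :: "nat \<Rightarrow> nat \<Rightarrow> nat list \<Rightarrow> nat set" where
  "loaded n l xs = {i\<in>{1..n}. l \<le> count_list xs i}"

lemma finite_loaded [simp]: "finite (loaded n l xs)"
  by (simp add: loaded_def)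

text \<open>Either at least \<open>r\<close> redraws are consumed, and the prefix
  \<open>take r vs\<close> already loads a bin, or fewer than \<open>r\<close> bins are spoiled and
  one of the more than \<open>r\<close> bins loaded by \<open>us\<close> keeps all its
  balls.\<close>

lemma loaded_redirect_nonempty:
  assumes len: "length us \<le> length vs"
    and us: "r < card (loaded n l us)" and vs: "loaded n l (take r vs) \<noteq> {}"
  shows "loaded n l (redirect Q us vs []) \<noteq> {}"
proof -
  let ?r = "redirect Q us vs []"
  obtain k D where kD: 
      "\<And>i. count_list (take k vs) i \<le> count_list ?r i"
      "finite D" "card D \<le> k"
      "\<And>i. i \<notin> D \<Longrightarrow> count_list us i \<le> count_list ?r i"
    using redirect_loads[OF len, of Q "[]"] by auto
  show ?thesis
  proof (cases "r \<le> k")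
    case True
    have "count_list (take r vs) i \<le> count_list (take k vs) i" for i
      using count_list_take_le[of r "take k vs"] True by (simp add: min_def)
    then show ?thesis using vs kD(1) unfolding loaded_def by (fastforce intro: order_trans)
  next
    case False
    then have "card D < card (loaded n l us)" using kD(3) us by linarith
    then obtain i where "i \<in> loaded n l us" "i \<notin> D"
      using kD(2) by (metis card_mono linorder_not_less subsetI)
    then show ?thesis using kD(4)[of i] unfolding loaded_def by (fastforce intro: order_trans)
  qed
qed

section \<open>Probability estimates for independent draws\<close>

lemma measure_bind_pmf: "measure (bind_pmf p f) A = (\<integral>x. measure (f x) A \<partial>p)"
  unfolding measure_pmf_bind
  by (rule subprob_space.measure_bind[where N="count_space UNIV"])
     (auto simp: measure_pmf_in_subprob_algebra subprob_space_measure_pmf)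

text \<open>A two-stage union bound: either the first stage is bad, or the second fails after a good
  first stage. The restriction to the support makes the length of a sampled list available.\<close>

lemma measure_bind_pmf_le:
  assumes "c \<ge> 0" and "\<And>x. x \<in> set_pmf p \<Longrightarrow> x \<notin> B \<Longrightarrow> measure (measure_pmf (f x)) A \<le> c"
  shows "measure (measure_pmf (bind_pmf p f)) A \<le> measure (measure_pmf p) B + c"
proof -
  have "measure (bind_pmf p f) A = (\<integral>x. measure (f x) A \<partial>p)"
    by (rule measure_bind_pmf)
  also have "\<dots> \<le> (\<integral>x. indicator B x + c \<partial>p)"
  proof (rule integral_mono_AE)
    show "integrable p (\<lambda>x. measure (f x) A)"
      by (rule measure_pmf.integrable_const_bound[where B=1]) auto
    show "integrable p (\<lambda>x. indicator B x + c)"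
      by (rule measure_pmf.integrable_const_bound[where B="1 + c"])
         (use assms(1) in \<open>auto simp: indicator_def\<close>)
    show "AE x in p. measure (f x) A \<le> indicator B x + c"
      unfolding AE_measure_pmf_iff
      using assms by (auto simp: indicator_def intro: add_increasing2)
  qed
  also have "\<dots> = measure p B + c"
    by (subst Bochner_Integration.integral_add)
       (auto intro: measure_pmf.integrable_const_bound[where B=1])
  finally show ?thesis .
qed

lemma replicate_pmf_avoid:
  "measure (replicate_pmf w p) {xs. set xs \<inter> D = {}} = measure p (- D) ^ w"
proof (induction w)
  case 0
  show ?case by simp
next
  case (Suc w)
  have "measure (replicate_pmf (Suc w) p) {xs. set xs \<inter> D = {}} =
    (\<integral>x. measure (map_pmf ((#) x) (replicate_pmf w p)) {xs. set xs \<inter> D = {}} \<partial>p)"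
    by (simp add: map_pmf_def measure_bind_pmf)
  also have "\<dots> = (\<integral>x. indicator (- D) x * measure p (- D) ^ w \<partial>p)"
    using Suc.IH by (intro Bochner_Integration.integral_cong) (auto simp: vimage_def indicator_def)
  finally show ?case by simp
qed

text \<open>A single term of the expansion of \<open>(1 + x) ^ s\<close> is at most
  \<open>exp (x * s)\<close>. The parameter \<open>x\<close> is left free, to be tuned to the size
  of \<open>q / s\<close>.\<close>

lemma binomial_le_exp:
  assumes "x > 0"
  shows "real (s choose q) \<le> exp (real q * ln (1 / x) + x * real s)"
proof (cases "q \<le> s")
  case True
  have "real (s choose q) * x ^ q \<le> (\<Sum>k\<le>s. real (s choose k) * x ^ k)"
    using assms True by (intro member_le_sum) auto
  also have "\<dots> = (x + 1) ^ s"
    by (simp add: binomial_ring)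
  also have "\<dots> \<le> exp x ^ s"
    using assms by (intro power_mono) (auto simp: add.commute)
  finally have "real (s choose q) * x ^ q \<le> exp (x * real s)"
    by (simp add: exp_of_nat2_mult)
  moreover have "exp (real q * ln (1 / x)) = 1 / x ^ q"
    using assms by (simp add: exp_of_nat_mult exp_minus ln_div divide_inverse power_inverse)
  ultimately show ?thesis
    using assms by (simp only: exp_add) (simp add: field_simps)
qed (simp add: binomial_eq_0)

text \<open>If at most \<open>q\<close> bins of \<open>S\<close> are hit, some \<open>T\<close> of
  size \<open>q\<close> inside \<open>S\<close> contains all hits, and the \<open>w\<close> balls
  miss \<open>S - T\<close>. A union bound over \<open>T\<close> wins because \<open>q\<close> is so
  small a part of \<open>S\<close> that the number of choices of \<open>T\<close> is outweighed by
  the probability of missing \<open>S - T\<close>.\<close>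

lemma few_hits_prob_le:
  fixes n w :: nat and S :: "nat set"
  defines "\<mu> \<equiv> real w / real n"
  assumes w: "0 < w" "w \<le> n" and S: "S \<subseteq> {1..n}"
  shows "measure (replicate_pmf w (pmf_of_set {1..n}))
      {xs. real (card (set xs \<inter> S)) < \<mu>\<^sup>2 / 8 * real (card S)} \<le> exp (- (\<mu> * real (card S) / 4))"
    (is "measure ?P ?B \<le> _")
proof -
  define s where "s = card S"
  define q where "q = nat \<lfloor>\<mu>\<^sup>2 / 8 * real s\<rfloor>"
  have n: "n > 0" using w by linarith
  have mu: "0 < \<mu>" "\<mu> \<le> 1" using w n by (auto simp: \<mu>_def)
  have fin: "finite S" using S finite_subset by blast
  have q: "real q \<le> \<mu>\<^sup>2 / 8 * real s" unfolding q_def by (intro of_nat_floor) simp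
  have "\<mu>\<^sup>2 \<le> 1" using mu by (simp add: power_le_one)
  then have "\<mu>\<^sup>2 / 8 * real s \<le> real s" by (intro mult_left_le_one_le) auto
  \<comment> \<open>This lets the set of hits be padded to a subset of \<open>S\<close> of size
    exactly \<open>q\<close>, and makes the natural subtraction \<open>s - q\<close> exact.\<close>
  then have qs: "q \<le> s" using q by linarith
  let ?F = "{T. T \<subseteq> S \<and> card T = q}"
  have cardF: "card ?F = s choose q" unfolding s_def using n_subsets[OF fin] by simp
  have finF: "finite ?F" using fin by simp
  have "?B \<subseteq> (\<Union>T\<in>?F. {xs. set xs \<inter> (S - T) = {}})"
  proof
    fix xs assume "xs \<in> ?B"
    then have "real (card (set xs \<inter> S)) < \<mu>\<^sup>2 / 8 * real s" by (simp add: s_def)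
    then have "card (set xs \<inter> S) \<le> q" unfolding q_def by (simp add: le_nat_floor)
    then obtain T where "set xs \<inter> S \<subseteq> T" "T \<subseteq> S" "card T = q"
      using exists_subset_between[of "set xs \<inter> S" q S] qs fin unfolding s_def by auto
    then show "xs \<in> (\<Union>T\<in>?F. {xs. set xs \<inter> (S - T) = {}})" by blast
  qed
  then have "measure ?P ?B \<le> measure ?P (\<Union>T\<in>?F. {xs. set xs \<inter> (S - T) = {}})"
    by (intro measure_pmf.finite_measure_mono) auto
  also have "\<dots> \<le> (\<Sum>T\<in>?F. measure ?P {xs. set xs \<inter> (S - T) = {}})"
    by (intro measure_pmf.finite_measure_subadditive_finite finF) auto
  also have "\<dots> \<le> (\<Sum>T\<in>?F. exp (- (\<mu> * (real s - real q))))"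
  proof (intro sum_mono)
    fix T assume T: "T \<in> ?F"
    have "measure (pmf_of_set {1..n}) (- (S - T)) = 1 - measure (pmf_of_set {1..n}) (S - T)"
      using measure_pmf.prob_compl[of "S - T" "pmf_of_set {1..n}"] by (simp add: Compl_eq_Diff_UNIV)
    also have "measure (pmf_of_set {1..n}) (S - T) = real (card (S - T)) / real n"
    proof -
      have "{1..n} \<inter> (S - T) = S - T" using S by auto
      then show ?thesis using n by (simp add: measure_pmf_of_set)
    qed
    also have "card (S - T) = s - q"
      using T fin by (auto simp: s_def card_Diff_subset finite_subset)
    also have "real (s - q) = real s - real q" using qs by simp
    finally have m: "measure (pmf_of_set {1..n}) (- (S - T)) = 1 - (real s - real q) / real n" .
    have "(1 - (real s - real q) / real n) ^ w \<le> exp (- ((real s - real q) / real n)) ^ w"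
      using m measure_nonneg[of "pmf_of_set {1..n}" "- (S - T)"]
        exp_ge_add_one_self[of "- ((real s - real q) / real n)"]
      by (intro power_mono) auto
    also have "\<dots> = exp (- (\<mu> * (real s - real q)))"
      by (simp add: exp_of_nat_mult[symmetric] \<mu>_def)
    finally show "measure ?P {xs. set xs \<inter> (S - T) = {}} \<le> exp (- (\<mu> * (real s - real q)))"
      unfolding replicate_pmf_avoid m .
  qed
  also have "\<dots> = real (s choose q) * exp (- (\<mu> * (real s - real q)))"
    by (simp add: cardF)
  \<comment> \<open>With \<open>x = \<mu> / 4\<close> the binomial coefficient costs \<mu>s/4 plus q
    ln(4/\<mu>). The terms in \<open>q\<close> add up to at most 4q/\<mu>, hence at most \<mu>s/2,
    so \<mu>s/4 of the decay remains.\<close>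
  also have "\<dots> \<le> exp (real q * ln (1 / (\<mu> / 4)) + \<mu> / 4 * real s) * exp (- (\<mu> * (real s - real q)))"
    using mu by (intro mult_right_mono binomial_le_exp) auto
  also have "\<dots> = exp (real q * (ln (4 / \<mu>) + \<mu>) - 3 / 4 * \<mu> * real s)"
    by (simp add: exp_add[symmetric] algebra_simps)
  also have "\<dots> \<le> exp (- (\<mu> * real s / 4))"
  proof -
    have "ln (4 / \<mu>) \<le> 4 / \<mu> - 1" using mu by (intro ln_le_minus_one) auto
    then have "ln (4 / \<mu>) + \<mu> \<le> 4 / \<mu>" using mu by linarith
    then have "real q * (ln (4 / \<mu>) + \<mu>) \<le> real q * (4 / \<mu>)" by (intro mult_left_mono) auto
    also have "\<dots> \<le> \<mu>\<^sup>2 / 8 * real s * (4 / \<mu>)" using q mu by (intro mult_right_mono) auto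
    also have "\<dots> = \<mu> * real s / 2" using mu by (simp add: power2_eq_square)
    finally show ?thesis by simp
  qed
  finally show ?thesis by (simp add: s_def)
qed

section \<open>One-choice allocation in phases\<close>

lemma loaded_append_Suc: "set ys \<inter> loaded n j xs \<subseteq> loaded n (Suc j) (xs @ ys)"
proof
  fix i assume i: "i \<in> set ys \<inter> loaded n j xs"
  then have "0 < count_list ys i" by (metis IntD1 count_list_0_iff gr0I)
  with i show "i \<in> loaded n (Suc j) (xs @ ys)" by (simp add: loaded_def)
qed

text \<open>Induction on the phases: given the first \<open>j\<close> phases, the bins loaded so far
  form a fixed set, and the next \<open>w\<close> fresh balls hit at least a fraction \<mu>*\<mu>/8
  of it except with small probability.\<close>

lemma few_loaded_phases_prob_le:
  fixes n w :: nat
  defines "\<mu> \<equiv> real w / real n"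
  assumes w: "0 < w" "w \<le> n"
  shows "measure (replicate_pmf (j * w) (pmf_of_set {1..n}))
      {xs. real (card (loaded n j xs)) < real n * (\<mu>\<^sup>2 / 8) ^ j}
    \<le> real j * exp (- (\<mu> * (real n * (\<mu>\<^sup>2 / 8) ^ j) / 4))"
proof (induction j)
  case 0
  have "{i \<in> {1..n}. 0 \<le> count_list xs i} = {1..n}" for xs by auto
  then show ?case by (simp only: loaded_def) simp
next
  case (Suc j)
  let ?U = "pmf_of_set {1..n}"
  let ?g = "\<mu>\<^sup>2 / 8"
  let ?e = "\<lambda>j. exp (- (\<mu> * (real n * ?g ^ j) / 4))"
  let ?B = "\<lambda>j. {xs. real (card (loaded n j xs)) < real n * ?g ^ j}"
  have n: "n > 0" using w by linarith
  have mu: "0 < \<mu>" "\<mu> \<le> 1" using w n by (auto simp: \<mu>_def)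
  have g: "0 < ?g" "?g \<le> 1" using mu power_le_one[of \<mu> 2] by auto
  \<comment> \<open>The guaranteed sets shrink, so later phases have larger error bounds and the
    last one may stand for all of them.\<close>
  have e: "?e j \<le> ?e (Suc j)"
    using g mu by (auto intro!: mult_left_mono mult_left_le_one_le mult_nonneg_nonneg)
  have "measure (replicate_pmf (Suc j * w) ?U) (?B (Suc j)) =
    measure (measure_pmf (do {xs \<leftarrow> replicate_pmf (j * w) ?U; map_pmf ((@) xs) (replicate_pmf w ?U)})) (?B (Suc j))"
    by (simp add: add.commute[of w] replicate_pmf_distrib map_pmf_def)
  also have "\<dots> \<le> measure (replicate_pmf (j * w) ?U) (?B j) + ?e j"
  proof (rule measure_bind_pmf_le)
    fix xs assume xs: "xs \<notin> ?B j"
    let ?S = "loaded n j xs"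
    have "real n * ?g ^ j \<le> real (card ?S)" using xs by simp
    have "measure (map_pmf ((@) xs) (replicate_pmf w ?U)) (?B (Suc j)) =
        measure (replicate_pmf w ?U) {ys. xs @ ys \<in> ?B (Suc j)}"
      by (simp add: vimage_def)
    also have "\<dots> \<le> measure (replicate_pmf w ?U) {ys. real (card (set ys \<inter> ?S)) < ?g * real (card ?S)}"
    proof (intro measure_pmf.finite_measure_mono subsetI CollectI)
      fix ys assume "ys \<in> {ys. xs @ ys \<in> ?B (Suc j)}"
      then have *: "real (card (loaded n (Suc j) (xs @ ys))) < real n * ?g ^ Suc j" by simp
      have "real (card (set ys \<inter> ?S)) \<le> real (card (loaded n (Suc j) (xs @ ys)))"
        by (intro of_nat_mono card_mono loaded_append_Suc) simp
      also note *
      also have "real n * ?g ^ Suc j = ?g * (real n * ?g ^ j)" by simp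
      also have "\<dots> \<le> ?g * real (card ?S)" using xs g by (intro mult_left_mono) auto
      finally show "real (card (set ys \<inter> ?S)) < ?g * real (card ?S)" .
    qed auto
    also have "\<dots> \<le> exp (- (\<mu> * real (card ?S) / 4))"
      unfolding \<mu>_def using w by (intro few_hits_prob_le) (auto simp: loaded_def)
    also have "\<dots> \<le> ?e j"
      using xs mu by (auto intro!: mult_left_mono)
    finally show "measure (map_pmf ((@) xs) (replicate_pmf w ?U)) (?B (Suc j)) \<le> ?e j" .
  qed simp
  also have "\<dots> \<le> real j * ?e j + ?e j" using Suc.IH by simp
  also have "\<dots> = real (Suc j) * ?e j" by (simp add: algebra_simps)
  also have "\<dots> \<le> real (Suc j) * ?e (Suc j)" using e by (intro mult_left_mono) auto
  finally show ?case .
qed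


lemma map_take_replicate_pmf:
  assumes "k \<le> M"
  shows "map_pmf (take k) (replicate_pmf M p) = replicate_pmf k p"
proof -
  have "map_pmf (take k) (replicate_pmf M p) =
    do {xs \<leftarrow> replicate_pmf k p; ys \<leftarrow> replicate_pmf (M - k) p; return_pmf (take k (xs @ ys))}"
    using replicate_pmf_distrib[of k "M - k" p] assms
    by (simp add: map_pmf_def bind_assoc_pmf bind_return_pmf)
  also have "\<dots> = do {xs \<leftarrow> replicate_pmf k p; ys \<leftarrow> replicate_pmf (M - k) p; return_pmf xs}"
    by (intro bind_pmf_cong refl) (simp add: set_replicate_pmf)
  finally show ?thesis by (simp add: bind_return_pmf')
qed

text \<open>Only the first \<open>l * w\<close> of the \<open>M\<close> draws are inspected, and
  these are again independent and uniform.\<close>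

lemma few_loaded_prob_le:
  fixes n w :: nat
  defines "\<mu> \<equiv> real w / real n"
  assumes w: "0 < w" "w \<le> n" and M: "l * w \<le> M"
  shows "measure (replicate_pmf M (pmf_of_set {1..n}))
      {xs. real (card (loaded n l (take (l * w) xs))) < real n * (\<mu>\<^sup>2 / 8) ^ l}
    \<le> real l * exp (- (\<mu> * (real n * (\<mu>\<^sup>2 / 8) ^ l) / 4))"
proof -
  have "measure (replicate_pmf M (pmf_of_set {1..n}))
      {xs. real (card (loaded n l (take (l * w) xs))) < real n * (\<mu>\<^sup>2 / 8) ^ l} =
    measure (map_pmf (take (l * w)) (replicate_pmf M (pmf_of_set {1..n})))
      {xs. real (card (loaded n l xs)) < real n * (\<mu>\<^sup>2 / 8) ^ l}"
    by (simp add: vimage_def)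
  then show ?thesis
    using few_loaded_phases_prob_le[OF w, of l]
    unfolding map_take_replicate_pmf[OF M] \<mu>_def by simp
qed

section \<open>Transfer to the one-query process\<close>

text \<open>The phase lengths are \<open>w1\<close> for the redraws and \<open>w2\<close> for the
  first draws, and the case split on the number of redraws is at \<open>l * w1\<close>. Hypothesis
  \<open>r\<close> says that the first draws load more bins than fewer than \<open>l * w1\<close>
  redraws can spoil. The event records the number of balls because the gap depends on it.\<close>

lemma one_query_process_loaded_prob_ge:
  fixes n l m w1 w2 :: nat
  defines "\<mu>1 \<equiv> real w1 / real n" and "\<mu>2 \<equiv> real w2 / real n"
  assumes w1: "0 < w1" "w1 \<le> n" "l * w1 \<le> m"
    and w2: "0 < w2" "w2 \<le> n" "l * w2 \<le> m"
    and r: "real (l * w1) < real n * (\<mu>2\<^sup>2 / 8) ^ l"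
  shows "measure (one_query_process n Q m) {h. length h = m \<and> loaded n l h \<noteq> {}} \<ge>
    1 - real l * (exp (- (\<mu>1 * (real n * (\<mu>1\<^sup>2 / 8) ^ l) / 4)) +
                  exp (- (\<mu>2 * (real n * (\<mu>2\<^sup>2 / 8) ^ l) / 4)))"
proof -
  let ?R = "replicate_pmf m (pmf_of_set {1..n})"
  let ?A = "{h. length h = m \<and> loaded n l h \<noteq> {}}"
  let ?e1 = "real l * exp (- (\<mu>1 * (real n * (\<mu>1\<^sup>2 / 8) ^ l) / 4))"
  let ?e2 = "real l * exp (- (\<mu>2 * (real n * (\<mu>2\<^sup>2 / 8) ^ l) / 4))"
  let ?B2 = "{us. real (card (loaded n l (take (l * w2) us))) < real n * (\<mu>2\<^sup>2 / 8) ^ l}"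
  have n: "n > 0" using w1 by linarith
  have "measure (one_query_process n Q m) (- ?A) =
    measure (measure_pmf (do {us \<leftarrow> ?R; map_pmf (\<lambda>vs. redirect Q us vs []) ?R})) (- ?A)"
    by (simp add: one_query_process_conv_from one_query_from_conv_redirect[OF n order_refl] map_pmf_def)
  also have "\<dots> \<le> measure ?R ?B2 + ?e1"
  proof (rule measure_bind_pmf_le)
    fix us assume us: "us \<in> set_pmf ?R" "us \<notin> ?B2"
    have "loaded n l (take (l * w2) us) \<subseteq> loaded n l us"
      unfolding loaded_def by (auto intro: order_trans[OF _ count_list_take_le])
    then have "card (loaded n l (take (l * w2) us)) \<le> card (loaded n l us)"
      by (intro card_mono) simp_all
    then have "real (card (loaded n l (take (l * w2) us))) \<le> real (card (loaded n l us))" by simp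
    with us(2) r have "real (l * w1) < real (card (loaded n l us))" unfolding mem_Collect_eq by linarith
    then have card_us: "l * w1 < card (loaded n l us)" by (simp only: of_nat_less_iff)
    have len_us: "length us = m" using us(1) by (simp add: set_replicate_pmf)
    have "measure (map_pmf (\<lambda>vs. redirect Q us vs []) ?R) (- ?A) =
        measure ?R {vs. redirect Q us vs [] \<notin> ?A}"
      by (simp add: vimage_def)
    also have "\<dots> \<le> measure ?R
        {vs. real (card (loaded n l (take (l * w1) vs))) < real n * (\<mu>1\<^sup>2 / 8) ^ l}"
    proof (rule measure_pmf.finite_measure_mono_AE)
      \<comment> \<open>For the redraws one loaded bin is enough: as this bound is positive, having
        no loaded bin falls into the bad event.\<close>
      have pos: "0 < real n * (\<mu>1\<^sup>2 / 8) ^ l" using n w1 by (simp add: \<mu>1_def)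
      have "real (card (loaded n l (take (l * w1) vs))) < real n * (\<mu>1\<^sup>2 / 8) ^ l"
        if "vs \<in> set_pmf ?R" "redirect Q us vs [] \<notin> ?A" for vs
      proof -
        have len: "length us \<le> length vs" using that(1) len_us by (simp add: set_replicate_pmf)
        have "length (redirect Q us vs []) = m"
          using redirect_loads[OF len, of Q "[]"] len_us by auto
        then have "loaded n l (take (l * w1) vs) = {}"
          using loaded_redirect_nonempty[OF len card_us] that(2) by blast
        then show ?thesis using pos by simp
      qed
      then show "AE vs in ?R. vs \<in> {vs. redirect Q us vs [] \<notin> ?A} \<longrightarrow>
          vs \<in> {vs. real (card (loaded n l (take (l * w1) vs))) < real n * (\<mu>1\<^sup>2 / 8) ^ l}"
        by (simp add: AE_measure_pmf_iff)
    qed simp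
    also have "\<dots> \<le> ?e1" unfolding \<mu>1_def by (intro few_loaded_prob_le w1)
    finally show "measure (map_pmf (\<lambda>vs. redirect Q us vs []) ?R) (- ?A) \<le> ?e1" .
  qed simp
  also have "measure ?R ?B2 \<le> ?e2" unfolding \<mu>2_def by (intro few_loaded_prob_le w2)
  finally have "measure (one_query_process n Q m) (- ?A) \<le> ?e2 + ?e1" by simp
  moreover have "measure (one_query_process n Q m) (- ?A) = 1 - measure (one_query_process n Q m) ?A"
    using measure_pmf.prob_compl[of ?A "one_query_process n Q m"] by (simp add: Compl_eq_Diff_UNIV)
  ultimately show ?thesis by (simp add: algebra_simps)
qed

section \<open>Choice of parameters and asymptotics\<close>

lemma gap_ge_of_loaded:
  assumes "loaded n l h \<noteq> {}"
  shows "real l - real (length h) / real n \<le> gap n h"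
proof -
  from assms obtain i where i: "i \<in> {1..n}" "l \<le> load h i"
    by (auto simp: loaded_def load_def)
  have "load h i \<le> (MAX i\<in>{1..n}. load h i)" using i(1) by (intro Max_ge) auto
  with i(2) show ?thesis by (simp add: gap_def)
qed

text \<open>Replaces the rounded exponent \<open>l\<close> by a real upper bound \<open>y\<close>,
  so that later estimates involve only \<open>L\<close>.\<close>

lemma power_ge_exp:
  fixes x :: real
  assumes "exp (- c) \<le> x" "c \<ge> 0" "real l \<le> y"
  shows "exp (- (c * y)) \<le> x ^ l"
proof -
  have "exp (- (c * y)) \<le> exp (- (c * real l))" using assms by (simp add: mult_left_mono)
  also have "\<dots> = exp (- c) ^ l" by (simp add: exp_of_nat_mult[symmetric] mult.commute)
  also have "\<dots> \<le> x ^ l" using assms by (intro power_mono) auto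
  finally show ?thesis .
qed

text \<open>The failure bound for general phase lengths, with \<open>l\<close> replaced by the upper
  bound \<open>3 / 20 * L + 1\<close>, and \<mu>1 and \<mu>2 by the lower bounds
  \<open>exp (- L - 1)\<close> and \<open>1 / 4\<close>.\<close>

definition gap_error :: "nat \<Rightarrow> real" where
  "gap_error n = (let L = sqrt (ln (real n)) in (3 / 20 * L + 1) *
     (exp (- (exp (- L - 1) * (real n * exp (- ((2 * L + 5) * (3 / 20 * L + 1)))) / 4)) +
      exp (- (1 / 4 * (real n * exp (- (6 * (3 / 20 * L + 1)))) / 4))))"

text \<open>Since L*L = ln n, the two inner exponents have order n^(7/10 - o(1)) and n^(1 - o(1)),
  so the error decays faster than any power of \<open>n\<close>.\<close>

lemma gap_error_smallo: "gap_error \<in> o(\<lambda>n. 1 / (real n)\<^sup>2)"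
  unfolding gap_error_def Let_def by real_asymp

lemma eventually_one_query_process_gap:
  "\<forall>\<^sub>F n in sequentially. \<forall>Q.
     measure (one_query_process n Q (nat \<lfloor>1 / 10 * real n * sqrt (ln (real n))\<rfloor>))
       {h. gap n h \<ge> 1 / 20 * sqrt (ln (real n))} \<ge> 1 - gap_error n"
proof -
  \<comment> \<open>All phases fit into \<open>m\<close> balls, as the leading coefficients are 3/40
    and 1/10.\<close>
  have ev1: "\<forall>\<^sub>F n in sequentially. (3 / 20 * sqrt (ln (real n)) + 1) * (real n / 2) \<le>
      1 / 10 * real n * sqrt (ln (real n)) - 1"
    by real_asymp
  \<comment> \<open>The spoiled bins are outnumbered because 6 * 3/20 = 9/10 is below 1.\<close>
  have ev2: "\<forall>\<^sub>F n in sequentially. (3 / 20 * sqrt (ln (real n)) + 1) * (real n * exp (- sqrt (ln (real n)))) <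
      real n * exp (- (6 * (3 / 20 * sqrt (ln (real n)) + 1)))"
    by real_asymp
  \<comment> \<open>Rounding \<open>w1\<close> down costs at most a factor
    \<open>exp 1\<close>.\<close>
  have ev3: "\<forall>\<^sub>F n in sequentially. real n * exp (- sqrt (ln (real n)) - 1) + 1 \<le> real n * exp (- sqrt (ln (real n)))"
    by real_asymp
  have ev4: "\<forall>\<^sub>F n in sequentially. exp (- sqrt (ln (real n))) \<le> 1 / 2"
    by real_asymp
  show ?thesis
    using ev1 ev2 ev3 ev4 eventually_ge_at_top[of 2]
  proof eventually_elim
    case (elim n)
    define L where "L = sqrt (ln (real n))"
    define m where "m = nat \<lfloor>1 / 10 * real n * L\<rfloor>"
    \<comment> \<open>The target load 3/20 L is the average load L/10 plus the desired gap
      L/20.\<close>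
    define l where "l = nat \<lceil>3 / 20 * L\<rceil>"
    define w1 where "w1 = nat \<lfloor>real n * exp (- L)\<rfloor>"
    define w2 where "w2 = n div 2"
    define \<mu>1 where "\<mu>1 = real w1 / real n"
    define \<mu>2 where "\<mu>2 = real w2 / real n"
    note ev = elim[folded L_def]
    have n: "n \<ge> 2" by fact
    have L: "L \<ge> 0" using n by (simp add: L_def)
    have l: "3 / 20 * L \<le> real l" "real l \<le> 3 / 20 * L + 1"
      using L unfolding l_def by linarith+
    have m: "real m \<le> 1 / 10 * real n * L" "1 / 10 * real n * L - 1 \<le> real m"
      using L unfolding m_def by (simp_all add: of_nat_floor) linarith
    have w1: "real w1 \<le> real n * exp (- L)" "real n * exp (- L) - 1 \<le> real w1"
      unfolding w1_def by (simp_all add: of_nat_floor)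
    have w1_ge: "real n * exp (- L - 1) \<le> real w1" using w1(2) ev(3) by linarith
    moreover have "0 < real n * exp (- L - 1)" using n by simp
    ultimately have w1_pos: "0 < w1" by linarith
    have w2: "real n / 4 \<le> real w2" "real w2 \<le> real n / 2" "0 < w2" "w2 \<le> n"
      using n unfolding w2_def by linarith+
    have "real n * exp (- L) \<le> real n * (1 / 2)" using ev(4) by (intro mult_left_mono) auto
    then have w1_half: "real w1 \<le> real n / 2" using w1 by simp
    have lw: "l * w \<le> m" if "real w \<le> real n / 2" for w
    proof -
      have "real l * real w \<le> (3 / 20 * L + 1) * (real n / 2)"
        using that l L by (intro mult_mono) auto
      also have "\<dots> \<le> real m" using ev(1) m by linarith
      finally show ?thesis by (metis of_nat_le_iff of_nat_mult)
    qed
    have \<mu>: "exp (- L - 1) \<le> \<mu>1" "1 / 4 \<le> \<mu>2"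
      using w1_ge w2(1) n by (simp_all add: \<mu>1_def \<mu>2_def field_simps)
    have e3: "8 \<le> exp (3 :: real)"
    proof -
      have "(2 :: real) ^ 3 \<le> exp 1 ^ 3"
        using exp_ge_add_one_self[of 1] by (intro power_mono) auto
      then show ?thesis by (simp add: exp_of_nat_mult[symmetric])
    qed
    have e6: "128 \<le> exp (6 :: real)"
    proof -
      \<comment> \<open>The half step is needed for 128 = 8 * 16: using
        \<open>1 + x \<le> exp x\<close> at \<open>x = 1\<close> gives only 2^6 = 64, whereas
        (3/2)^12 exceeds 129.\<close>
      have "(3 / 2 :: real) ^ 12 \<le> exp (1 / 2) ^ 12"
        using exp_ge_add_one_self[of "1 / 2"] by (intro power_mono) auto
      then show ?thesis by (simp add: exp_of_nat_mult[symmetric] power_divide)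
    qed
    have \<gamma>1: "exp (- ((2 * L + 5) * (3 / 20 * L + 1))) \<le> (\<mu>1\<^sup>2 / 8) ^ l"
    proof (rule power_ge_exp)
      have "exp (- (2 * L + 5)) = (exp (- L - 1))\<^sup>2 / exp 3"
        by (simp add: exp_double[symmetric] exp_diff[symmetric])
      also have "\<dots> \<le> \<mu>1\<^sup>2 / 8"
        using \<mu>(1) e3 by (intro frac_le power_mono) auto
      finally show "exp (- (2 * L + 5)) \<le> \<mu>1\<^sup>2 / 8" .
    qed (use L l in auto)
    have \<gamma>2: "exp (- (6 * (3 / 20 * L + 1))) \<le> (\<mu>2\<^sup>2 / 8) ^ l"
    proof (rule power_ge_exp)
      have "exp (- 6) \<le> 1 / (128 :: real)"
        using e6 by (simp add: exp_minus field_simps)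
      also have "\<dots> = (1 / 4)\<^sup>2 / 8" by (simp add: power2_eq_square)
      also have "\<dots> \<le> \<mu>2\<^sup>2 / 8" using \<mu>(2) by (intro divide_right_mono power_mono) auto
      finally show "exp (- 6) \<le> \<mu>2\<^sup>2 / 8" .
    qed (use l in auto)
    have "real (l * w1) \<le> (3 / 20 * L + 1) * (real n * exp (- L))"
      using l L w1 by (simp add: mult_mono)
    also have "\<dots> < real n * exp (- (6 * (3 / 20 * L + 1)))" by (rule ev(2))
    also have "\<dots> \<le> real n * (\<mu>2\<^sup>2 / 8) ^ l" using \<gamma>2 by (intro mult_left_mono) auto
    finally have r: "real (l * w1) < real n * (\<mu>2\<^sup>2 / 8) ^ l" .
    have err: "real l * (exp (- (\<mu>1 * (real n * (\<mu>1\<^sup>2 / 8) ^ l) / 4)) +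
        exp (- (\<mu>2 * (real n * (\<mu>2\<^sup>2 / 8) ^ l) / 4))) \<le> gap_error n"
    proof -
      have "exp (- L - 1) * (real n * exp (- ((2 * L + 5) * (3 / 20 * L + 1)))) \<le>
          \<mu>1 * (real n * (\<mu>1\<^sup>2 / 8) ^ l)"
        using \<mu>(1) \<gamma>1 by (intro mult_mono) (auto intro: order_trans[OF exp_ge_zero])
      moreover have "1 / 4 * (real n * exp (- (6 * (3 / 20 * L + 1)))) \<le>
          \<mu>2 * (real n * (\<mu>2\<^sup>2 / 8) ^ l)"
        using \<mu>(2) \<gamma>2 by (intro mult_mono) auto
      ultimately show ?thesis
        unfolding gap_error_def Let_def L_def[symmetric]
        using l(2) L by (intro mult_mono add_mono) auto
    qed
    show ?case
    proof
      fix Q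
      have "1 - gap_error n \<le> measure (one_query_process n Q m) {h. length h = m \<and> loaded n l h \<noteq> {}}"
        using one_query_process_loaded_prob_ge[of w1 n l m w2 Q] err w1_pos w1_half w2 lw r n
        unfolding \<mu>1_def \<mu>2_def by fastforce
      also have "\<dots> \<le> measure (one_query_process n Q m) {h. gap n h \<ge> 1 / 20 * L}"
      proof (intro measure_pmf.finite_measure_mono subsetI CollectI)
        fix h assume h: "h \<in> {h. length h = m \<and> loaded n l h \<noteq> {}}"
        have "real m / real n \<le> 1 / 10 * L" using m(1) n by (simp add: field_simps)
        then show "1 / 20 * L \<le> gap n h"
          using gap_ge_of_loaded[of n l h] h l(1) by auto
      qed simp
      finally show "1 - gap_error n \<le>
        measure (one_query_process n Q (nat \<lfloor>1 / 10 * real n * sqrt (ln (real n))\<rfloor>))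
          {h. 1 / 20 * sqrt (ln (real n)) \<le> gap n h}"
        unfolding m_def L_def .
    qed
  qed
qed

theorem theorem4p2:
  fixes K :: real and m :: "nat \<Rightarrow> nat"
  assumes K: "K = 1 / 10"
    and m: "\<And>n. m n = nat \<lfloor>K * real n * sqrt (ln (real n))\<rfloor>"
  shows "\<exists>\<epsilon> :: nat \<Rightarrow> real. \<epsilon> \<in> o(\<lambda>n. 1 / (real n)\<^sup>2) \<and>
    (\<forall>\<^sub>F n in sequentially.
      (\<forall>rk \<delta>. adaptive_ranking n rk \<longrightarrow> adaptive_quantile n \<delta> \<longrightarrow>
         measure_pmf.prob (quantile_process n rk \<delta> (m n))
           {h. gap n h \<ge> 1 / 20 * sqrt (ln (real n))} \<ge> 1 - \<epsilon> n) \<and>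
      (\<forall>f. measure_pmf.prob (threshold_process n f (m n))
           {h. gap n h \<ge> 1 / 20 * sqrt (ln (real n))} \<ge> 1 - \<epsilon> n))"
\<comment> \<open>Both processes are one-query processes for suitable queries, and the bound by
  \<open>gap_error\<close> is uniform over all queries.\<close>
proof (intro exI[of _ gap_error] conjI gap_error_smallo)
  show "\<forall>\<^sub>F n in sequentially.
      (\<forall>rk \<delta>. adaptive_ranking n rk \<longrightarrow> adaptive_quantile n \<delta> \<longrightarrow>
         measure_pmf.prob (quantile_process n rk \<delta> (m n))
           {h. gap n h \<ge> 1 / 20 * sqrt (ln (real n))} \<ge> 1 - gap_error n) \<and>
      (\<forall>f. measure_pmf.prob (threshold_process n f (m n))
           {h. gap n h \<ge> 1 / 20 * sqrt (ln (real n))} \<ge> 1 - gap_error n)"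
    using eventually_one_query_process_gap
    by eventually_elim (simp add: quantile_process_def threshold_process_def m K)
qed

end
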